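(* Let $P$ be an ordinary point that does not lie on the extended sides of triangle $ABC$ or of its anticomplementary triangle, does not lie on a median of $ABC$, and whose isotomic conjugate $P'$ is ordinary (i.e. $P\notin\iota(l_\infty)$). Let $\lambda=T_{P'}\circ T_P^{-1}$. (a) One has $$A_0P\cdot D_0Q'=\lambda^{-1}(A),\quad B_0P\cdot E_0Q'=\lambda^{-1}(B),\quad C_0P\cdot F_0Q'=\lambda^{-1}(C);$$ $$A'_0P'\cdot D_0Q=\lambda(A),\quad B'_0P'\cdot E_0Q=\lambda(B),\quad C'_0P'\cdot F_0Q=\lambda(C).$$ (b) Moreover, the lines $A_0P, D_0Q', DQ, A'_3P'$ are concurrent at the point $\lambda^{-1}(A)$, and the lines $A'_0P', D_0Q, D_3Q', A_3P$ are concurrent at the point $\lambda(A)$. Similarly, $B_0P, E_0Q', EQ, B'_3P'$ are concurrent at $\lambda^{-1}(B)$ and $B'_0P', E_0Q, E_3Q', B_3P$ at $\lambda(B)$; and $C_0P, F_0Q', FQ, C'_3P'$ are concurrent at $\lambda^{-1}(C)$ and $C'_0P', F_0Q, F_3Q', C_3P$ at $\lambda(C)$.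
   Context: Work in the extended Euclidean plane: the Euclidean plane together with the line at infinity $l_\infty$. Points on $l_\infty$ are called infinite, all other points ordinary; affine maps are extended to $l_\infty$. $XY$ denotes the line through $X$ and $Y$, and $l\cdot m$ the intersection point of lines $l$ and $m$. $ABC$ is a (nondegenerate) triangle with centroid $G$; medians are the full lines $AG,BG,CG$. $K$ is the homothety with center $G$ and ratio $-1/2$; the anticomplementary triangle is $K^{-1}(ABC)$. $D_0,E_0,F_0$ are the midpoints of $BC,CA,AB$. $D=AP\cdot BC$, $E=BP\cdot CA$, $F=CP\cdot AB$ are the traces of $P$, and $D_3,E_3,F_3$ are the reflections of $D,E,F$ in $D_0,E_0,F_0$; the lines $AD_3,BE_3,CF_3$ meet in the isotomic conjugate $P'=\iota(P)$ of $P$. Put $Q=K(P')$, $Q'=K(P)$. $T_P$ is the unique affine map with $A\mapsto D$, $B\mapsto E$, $C\mapsto F$; $T_{P'}$ is the unique affine map with $A\mapsto D_3$, $B\mapsto E_3$, $C\mapsto F_3$. $A_0,B_0,C_0$ are the midpoints of $EF,FD,DE$; $A'_0,B'_0,C'_0$ are the midpoints of $E_3F_3,F_3D_3,D_3E_3$. $A_3=T_P(D_3)$, $B_3=T_P(E_3)$, $C_3=T_P(F_3)$ and $A'_3=T_{P'}(D)$, $B'_3=T_{P'}(E)$, $C'_3=T_{P'}(F)$. *)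

theory Defs
  imports "HOL-Analysis.Analysis"
begin

text \<open>The extended plane: the points of \<open>\<real>\<^sup>2\<close>, together with one point at infinity for
  each direction, a direction being a one-dimensional linear subspace of \<open>\<real>\<^sup>2\<close>.\<close>

typedef direction = "{S :: (real^2) set. subspace S \<and> dim S = 1}"
proof -
  have "dim (span {axis 1 1 :: real^2}) = 1"
    using dim_span dim_singleton[of "axis 1 1 :: real^2"] by (simp add: axis_eq_0_iff)
  then show ?thesis by (intro exI[of _ "span {axis 1 1 :: real^2}"]) (simp add: subspace_span)
qed

datatype xpoint = Ordinary (pt: "real^2") | Infinite direction

definition line_at_infinity :: "xpoint set" where
  "line_at_infinity = range Infinite"

definition extend_line :: "(real^2) set \<Rightarrow> xpoint set" where
  "extend_line l = Ordinary ` l \<union> {Infinite d | d. affine_parallel (Rep_direction d) l}"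

definition is_xline :: "xpoint set \<Rightarrow> bool" where
  "is_xline l \<longleftrightarrow> l = line_at_infinity \<or> (\<exists>m. affine m \<and> aff_dim m = 1 \<and> l = extend_line m)"

text \<open>\<open>xline X Y\<close> is a specific line only for \<open>X \<noteq> Y\<close>, and \<open>meet l m\<close> a specific point
  only for distinct lines; otherwise these are unspecified.\<close>

definition xline :: "xpoint \<Rightarrow> xpoint \<Rightarrow> xpoint set" where
  "xline X Y = (THE l. is_xline l \<and> X \<in> l \<and> Y \<in> l)"

definition meet :: "xpoint set \<Rightarrow> xpoint set \<Rightarrow> xpoint" where
  "meet l m = (THE X. X \<in> l \<and> X \<in> m)"

abbreviation line :: "real^2 \<Rightarrow> real^2 \<Rightarrow> xpoint set" where
  "line X Y \<equiv> xline (Ordinary X) (Ordinary Y)"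

definition concurrent_at :: "xpoint set set \<Rightarrow> xpoint \<Rightarrow> bool" where
  "concurrent_at L X \<longleftrightarrow> (\<forall>l\<in>L. is_xline l) \<and> \<Inter>L = {X}"

definition homothety :: "real^2 \<Rightarrow> real \<Rightarrow> real^2 \<Rightarrow> real^2" where
  "homothety c r X = c + r *\<^sub>R (X - c)"

definition reflect_in :: "real^2 \<Rightarrow> real^2 \<Rightarrow> real^2" where
  "reflect_in c X = homothety c (-1) X"

definition centroid :: "real^2 \<Rightarrow> real^2 \<Rightarrow> real^2 \<Rightarrow> real^2" where
  "centroid A B C = (1/3) *\<^sub>R (A + B + C)"

definition affine_map :: "(real^2 \<Rightarrow> real^2) \<Rightarrow> bool" where
  "affine_map T \<longleftrightarrow> (\<exists>L v. linear L \<and> (\<forall>X. T X = L X + v))"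

definition affine_map_taking ::
  "real^2 \<Rightarrow> real^2 \<Rightarrow> real^2 \<Rightarrow> real^2 \<Rightarrow> real^2 \<Rightarrow> real^2 \<Rightarrow> real^2 \<Rightarrow> real^2" where
  "affine_map_taking A B C X Y Z = (THE T. affine_map T \<and> T A = X \<and> T B = Y \<and> T C = Z)"

text \<open>\<open>cevian_trace A B C P\<close> is \<open>AP \<cdot> BC\<close> as a point of \<open>\<real>\<^sup>2\<close>; it is meaningful only when this
  intersection is ordinary, i.e. when \<open>P\<close> is not on the line through \<open>A\<close> parallel to \<open>BC\<close>
  (a side of the anticomplementary triangle).\<close>

definition cevian_trace :: "real^2 \<Rightarrow> real^2 \<Rightarrow> real^2 \<Rightarrow> real^2 \<Rightarrow> real^2" where
  "cevian_trace A B C P = pt (meet (line A P) (line B C))"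

text \<open>The isotomic conjugate of an ordinary point may be infinite.\<close>

definition isotomic :: "real^2 \<Rightarrow> real^2 \<Rightarrow> real^2 \<Rightarrow> real^2 \<Rightarrow> xpoint" where
  "isotomic A B C P = (THE X.
     X \<in> line A (reflect_in (midpoint B C) (cevian_trace A B C P)) \<and>
     X \<in> line B (reflect_in (midpoint C A) (cevian_trace B C A P)) \<and>
     X \<in> line C (reflect_in (midpoint A B) (cevian_trace C A B P)))"

end

theory Submission
  imports Defs
begin

text \<open>Everything is computed in homogeneous barycentric coordinates with respect to \<open>ABC\<close>.
  If \<open>P = (x : y : z)\<close>, the traces are \<open>D = (0 : y : z)\<close> and so on, reflection in the midpoint of a
  side exchanges two coordinates, so \<open>D\<^sub>3 = (0 : z : y)\<close>, and therefore \<open>P' = (yz : zx : xy)\<close>. The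
  homothety \<open>K\<close> sends \<open>(u : v : w)\<close> to \<open>(v + w : w + u : u + v)\<close>, which gives \<open>Q\<close> and \<open>Q'\<close>.

  Since \<open>-(0, y, z) + (x, 0, z) + (x, y, 0) = (2x, 0, 0)\<close>, one reads off
  \<open>T\<^sub>P\<^sup>-\<^sup>1(A) = (-(y + z) : z + x : x + y)\<close>, and applying \<open>T\<^sub>P\<^sub>'\<close> gives
  \<open>\<lambda>(A) = (y + z : x - z : x - y)\<close>. Write \<open>L\<close> for this triple and \<open>s = yz + zx + xy\<close>. The linear relations
  \<open>(2yz + zx + xy, x(z + x), x(x + y)) = x L + 2 (yz, zx, xy)\<close>,
  \<open>(x(y + z), y(z + x), z(x + y)) = x L + (s - x\<^sup>2) (0, 1, 1)\<close> and
  \<open>(y + z, z + x, x + y) = L + 2 (0, z, y)\<close>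
  say that \<open>\<lambda>(A)\<close> is on \<open>A'\<^sub>0P'\<close>, on \<open>D\<^sub>0Q\<close> and on \<open>D\<^sub>3Q'\<close>; for \<open>A\<^sub>3P\<close> a determinant
  vanishes. This is lemma \<open>vertex_concurrence\<close>.

  The other statements follow by symmetry. A cyclic permutation of the vertices gives \<open>\<lambda>(B)\<close> and
  \<open>\<lambda>(C)\<close> (lemma \<open>triangle_concurrence\<close>). Isotomic conjugation is an involution, and
  exchanging \<open>P\<close> with \<open>P'\<close> exchanges \<open>T\<^sub>P\<close> with \<open>T\<^sub>P\<^sub>'\<close> and \<open>Q\<close> with \<open>Q'\<close>, hence turns \<open>\<lambda>\<close> into its
  inverse, so the same lemma with \<open>(yz, zx, xy)\<close> in place of \<open>(x, y, z)\<close> gives the points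
  \<open>\<lambda>\<^sup>-\<^sup>1(A)\<close>, \<open>\<lambda>\<^sup>-\<^sup>1(B)\<close>, \<open>\<lambda>\<^sup>-\<^sup>1(C)\<close>.

  The hypotheses on \<open>P\<close> are the nondegeneracy conditions of this computation: \<open>xyz \<noteq> 0\<close> (off the sides),
  \<open>(y + z)(z + x)(x + y) \<noteq> 0\<close> (off the anticomplementary sides), pairwise distinct \<open>x, y, z\<close> (off
  the medians, which keeps \<open>A'\<^sub>0 \<noteq> P'\<close> and \<open>A\<^sub>3 \<noteq> P\<close>) and \<open>s \<noteq> 0\<close>. The last one is what
  \<open>P'\<close> being ordinary means: if \<open>s = 0\<close>, the three lines that define \<open>P'\<close> are parallel and
  share a point at infinity (lemma \<open>isotomic_eq_Ordinary\<close>).\<close>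

section \<open>Lines of the extended plane\<close>

lemma affine_line_eq_hull:
  fixes m :: "'a::euclidean_space set"
  assumes "affine m" "aff_dim m = 1" "X \<in> m" "Y \<in> m" "X \<noteq> Y"
  shows "m = affine hull {X, Y}"
proof -
  have "affine hull {X, Y} \<subseteq> m" using assms by (simp add: hull_minimal)
  moreover have "aff_dim (affine hull {X, Y}) = aff_dim m" using assms by (simp add: aff_dim_2)
  ultimately show ?thesis
    using assms affine_dim_equal[of "affine hull {X, Y}" m] by auto
qed

text \<open>Through a given point there is only one line with a given direction space.\<close>

lemma affine_eq_translate_direction:
  fixes m :: "'a::real_vector set"
  assumes "subspace S" "affine_parallel S m" "X \<in> m"
  shows "m = (+) X ` S"
proof -
  obtain a where m: "m = (+) a ` S" using assms(2) by (auto simp: affine_parallel_def)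
  then obtain s where s: "s \<in> S" "X = a + s" using assms(3) by auto
  show ?thesis
  proof (intro set_eqI iffI)
    fix y assume "y \<in> m"
    then obtain t where "t \<in> S" "y = a + t" using m by auto
    then have "y = X + (t - s)" "t - s \<in> S" using s assms(1) by (auto simp: subspace_diff)
    then show "y \<in> (+) X ` S" by blast
  next
    fix y assume "y \<in> (+) X ` S"
    then obtain t where "t \<in> S" "y = X + t" by auto
    then have "y = a + (s + t)" "s + t \<in> S" using s assms(1) by (auto simp: subspace_add)
    then show "y \<in> m" using m by blast
  qed
qed

lemma subspace_Rep_direction: "subspace (Rep_direction d)"
  using Rep_direction by auto

lemma Infinite_in_extend_line_unique:
  assumes "Infinite d \<in> extend_line m" "Infinite e \<in> extend_line m"
  shows "d = e"
proof -
  have "affine_parallel (Rep_direction d) m" "affine_parallel (Rep_direction e) m"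
    using assms by (auto simp: extend_line_def)
  then have "affine_parallel (Rep_direction d) (Rep_direction e)"
    using affine_parallel_commute affine_parallel_assoc by blast
  then have "Rep_direction d = Rep_direction e"
    using parallel_subspace subspace_Rep_direction by blast
  then show ?thesis by (simp add: Rep_direction_inject)
qed

lemma Ordinary_in_extend_line [simp]: "Ordinary X \<in> extend_line m \<longleftrightarrow> X \<in> m"
  by (auto simp: extend_line_def)

lemma Infinite_in_extend_line:
  "Infinite d \<in> extend_line m \<longleftrightarrow> affine_parallel (Rep_direction d) m"
  by (auto simp: extend_line_def)

lemma xline_through_Ordinary_cases:
  assumes "is_xline l" "Ordinary X \<in> l"
  obtains m where "affine m" "aff_dim m = 1" "l = extend_line m" "X \<in> m"
proof -
  have "l \<noteq> line_at_infinity" using assms(2) by (auto simp: line_at_infinity_def)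
  then obtain m where m: "affine m" "aff_dim m = 1" "l = extend_line m"
    using assms(1) unfolding is_xline_def by blast
  then have "X \<in> m" using assms(2) by simp
  then show ?thesis using m that by blast
qed

lemma xline_through_Ordinary_unique:
  assumes "is_xline l" "is_xline l'" "Ordinary X \<in> l" "Ordinary X \<in> l'"
    "Y \<in> l" "Y \<in> l'" "Y \<noteq> Ordinary X"
  shows "l = l'"
proof -
  obtain m where m: "affine m" "aff_dim m = 1" "l = extend_line m" "X \<in> m"
    by (rule xline_through_Ordinary_cases[OF assms(1,3)])
  obtain m' where m': "affine m'" "aff_dim m' = 1" "l' = extend_line m'" "X \<in> m'"
    by (rule xline_through_Ordinary_cases[OF assms(2,4)])
  have "m = m'"
  proof (cases Y)
    case (Ordinary Z)
    then show ?thesis using affine_line_eq_hull[of m X Z] affine_line_eq_hull[of m' X Z] m m' assms by auto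
  next
    case (Infinite d)
    have "k = (+) X ` Rep_direction d" if "Infinite d \<in> extend_line k" "X \<in> k" for k
      using affine_eq_translate_direction[OF subspace_Rep_direction] that
      by (simp add: Infinite_in_extend_line)
    from this[of m] this[of m'] show ?thesis using m m' assms(5,6) Infinite by simp
  qed
  then show ?thesis using m m' by simp
qed

text \<open>This axiom of the projective plane is what makes \<open>xline\<close> and \<open>meet\<close>
  well defined. If both points are infinite, the line can only be the one at infinity, because an
  ordinary line has a single direction.\<close>

lemma xline_unique:
  assumes "is_xline l" "is_xline l'" "X \<noteq> Y" "X \<in> l" "X \<in> l'" "Y \<in> l" "Y \<in> l'"
  shows "l = l'"
proof (cases X)
  case (Ordinary Z)
  then show ?thesis using xline_through_Ordinary_unique[of l l' Z Y] assms by auto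
next
  case X: (Infinite d)
  show ?thesis
  proof (cases Y)
    case (Ordinary Z)
    then show ?thesis using xline_through_Ordinary_unique[of l l' Z X] assms by auto
  next
    case (Infinite e)
    then have "d \<noteq> e" using X assms by auto
    then have "k = line_at_infinity" if "is_xline k" "X \<in> k" "Y \<in> k" for k
      using that X Infinite Infinite_in_extend_line_unique[of d _ e] by (auto simp: is_xline_def)
    from this[of l] this[of l'] show ?thesis using assms by simp
  qed
qed

lemma
  assumes "X \<noteq> Y"
  shows line_eq_extend_line: "line X Y = extend_line (affine hull {X, Y})"
    and is_xline_line: "is_xline (line X Y)"
proof -
  have *: "is_xline (extend_line (affine hull {X, Y}))"
    unfolding is_xline_def
    by (intro disjI2 exI[of _ "affine hull {X, Y}"]) (use assms in simp)
  have on: "Ordinary X \<in> extend_line (affine hull {X, Y})" "Ordinary Y \<in> extend_line (affine hull {X, Y})"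
    by (simp_all add: hull_inc)
  show eq: "line X Y = extend_line (affine hull {X, Y})"
    unfolding xline_def
  proof (rule the_equality)
    fix l assume l: "is_xline l \<and> Ordinary X \<in> l \<and> Ordinary Y \<in> l"
    have "Ordinary X \<noteq> Ordinary Y" using assms by simp
    then show "l = extend_line (affine hull {X, Y})"
      by (rule xline_unique[rotated 2]) (use l * on in blast)+
  qed (use * on in blast)
  show "is_xline (line X Y)" using * eq by simp
qed

text \<open>The common factor \<open>w\<close> is explicit so that the same infinite point can be
  recognised on several parallel lines, whose difference vectors are different multiples of \<open>w\<close>.\<close>

lemma Infinite_in_line:
  assumes "X \<noteq> Y" "w \<noteq> 0" "Y - X = c *\<^sub>R w"
  shows "Infinite (Abs_direction (span {w})) \<in> line X Y"
proof -
  have "Rep_direction (Abs_direction (span {w})) = span {w}"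
    using assms(2) by (intro Abs_direction_inverse) (simp add: dim_singleton)
  moreover have "affine hull {X, Y} = (+) X ` span {w}"
  proof -
    have "c \<noteq> 0" using assms by auto
    have dir: "X + u *\<^sub>R (Y - X) = X + (u * c) *\<^sub>R w" for u using assms(3) by simp
    show ?thesis unfolding affine_hull_2_alt span_singleton
    proof (intro set_eqI iffI)
      fix Z assume "Z \<in> range (\<lambda>u. X + u *\<^sub>R (Y - X))"
      then show "Z \<in> (+) X ` range (\<lambda>k. k *\<^sub>R w)" unfolding dir by blast
    next
      fix Z assume "Z \<in> (+) X ` range (\<lambda>k. k *\<^sub>R w)"
      then obtain k where "Z = X + k *\<^sub>R w" by blast
      then have "Z = X + (k / c) *\<^sub>R (Y - X)" unfolding dir using \<open>c \<noteq> 0\<close> by simp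
      then show "Z \<in> range (\<lambda>u. X + u *\<^sub>R (Y - X))" by blast
    qed
  qed
  ultimately show ?thesis
    using assms(1) by (auto simp: line_eq_extend_line Infinite_in_extend_line affine_parallel_def)
qed

lemma Ordinary_endpoints_in_line:
  assumes "X \<noteq> Y"
  shows "Ordinary X \<in> line X Y" "Ordinary Y \<in> line X Y"
  using assms by (simp_all add: line_eq_extend_line hull_inc)

lemma meet_eqI:
  assumes "is_xline l" "is_xline m" "l \<noteq> m" "X \<in> l" "X \<in> m"
  shows "meet l m = X"
  unfolding meet_def
proof (rule the_equality)
  fix Y assume "Y \<in> l \<and> Y \<in> m"
  then show "Y = X" using xline_unique[of l m X Y] assms by auto
qed (use assms in simp)

text \<open>Two of the lines being distinct is enough to pin down the intersection; the
  others may coincide with them.\<close>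

lemma concurrent_atI:
  assumes "\<And>l. l \<in> L \<Longrightarrow> is_xline l \<and> X \<in> l" "l \<in> L" "m \<in> L" "l \<noteq> m"
  shows "concurrent_at L X"
proof -
  have "Y = X" if "Y \<in> \<Inter>L" for Y
    using xline_unique[of l m X Y] assms(1)[of l] assms(1)[of m] assms(2-4) that by auto
  then show ?thesis using assms(1) unfolding concurrent_at_def by auto
qed

section \<open>Barycentric coordinates\<close>

text \<open>Twice the signed area of the triangle.\<close>

definition area2 :: "real^2 \<Rightarrow> real^2 \<Rightarrow> real^2 \<Rightarrow> real" where
  "area2 X Y Z = (Y $ 1 - X $ 1) * (Z $ 2 - X $ 2) - (Y $ 2 - X $ 2) * (Z $ 1 - X $ 1)"

definition det3 :: "real \<Rightarrow> real \<Rightarrow> real \<Rightarrow> real \<Rightarrow> real \<Rightarrow> real \<Rightarrow> real \<Rightarrow> real \<Rightarrow> real \<Rightarrow> real" where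
  "det3 a b c d e f g h i = a * (e * i - f * h) - b * (d * i - f * g) + c * (d * h - e * g)"

text \<open>The weights are homogeneous: only their ratio matters, and the point has a meaning only when
  their sum is nonzero.\<close>

definition bary :: "'a \<Rightarrow> 'a \<Rightarrow> 'a \<Rightarrow> real \<Rightarrow> real \<Rightarrow> real \<Rightarrow> 'a::real_vector" where
  "bary A B C x y z = (1 / (x + y + z)) *\<^sub>R (x *\<^sub>R A + y *\<^sub>R B + z *\<^sub>R C)"

lemma in_affine_hull_iff_area2:
  assumes "X \<noteq> Y"
  shows "Z \<in> affine hull {X, Y} \<longleftrightarrow> area2 X Y Z = 0"
proof
  assume "Z \<in> affine hull {X, Y}"
  then obtain u where "Z = X + u *\<^sub>R (Y - X)" by (auto simp: affine_hull_2_alt)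
  then show "area2 X Y Z = 0" by (simp add: area2_def)
next
  assume area: "area2 X Y Z = 0"
  have "\<exists>u. Z $ 1 - X $ 1 = u * (Y $ 1 - X $ 1) \<and> Z $ 2 - X $ 2 = u * (Y $ 2 - X $ 2)"
  proof (cases "X $ 1 = Y $ 1")
    case True
    then have "X $ 2 \<noteq> Y $ 2" using assms by (auto simp: vec_eq_iff forall_2)
    then show ?thesis using area True
      by (intro exI[of _ "(Z $ 2 - X $ 2) / (Y $ 2 - X $ 2)"]) (simp add: area2_def)
  next
    case False
    then have "Z $ 2 - X $ 2 = (Y $ 2 - X $ 2) * (Z $ 1 - X $ 1) / (Y $ 1 - X $ 1)"
      using area by (subst eq_divide_eq) (simp add: area2_def mult.commute)
    then show ?thesis using False
      by (intro exI[of _ "(Z $ 1 - X $ 1) / (Y $ 1 - X $ 1)"]) simp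
  qed
  then obtain u where "Z $ 1 - X $ 1 = u * (Y $ 1 - X $ 1)" "Z $ 2 - X $ 2 = u * (Y $ 2 - X $ 2)"
    by blast
  then have "Z - X = u *\<^sub>R (Y - X)" by (simp add: vec_eq_iff forall_2)
  then have "Z = X + u *\<^sub>R (Y - X)" by (simp add: diff_eq_eq add.commute)
  then show "Z \<in> affine hull {X, Y}" by (auto simp: affine_hull_2_alt)
qed

text \<open>The signed area is a determinant of homogeneous Cartesian coordinates \<open>(X\<^sub>1, X\<^sub>2, 1)\<close>, and
  these arise from the weights by multiplication with the matrix of \<open>A, B, C\<close>; so this is the
  product rule for determinants, divided by the normalising factors.\<close>

lemma area2_bary:
  assumes "x + y + z \<noteq> 0" "x' + y' + z' \<noteq> 0" "x'' + y'' + z'' \<noteq> 0"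
  shows "area2 (bary A B C x y z) (bary A B C x' y' z') (bary A B C x'' y'' z'') =
    det3 x y z x' y' z' x'' y'' z'' / ((x + y + z) * (x' + y' + z') * (x'' + y'' + z'')) * area2 A B C"
proof -
  have hom: "area2 X Y Z = det3 (X $ 1) (X $ 2) 1 (Y $ 1) (Y $ 2) 1 (Z $ 1) (Z $ 2) 1" for X Y Z
    by (simp add: area2_def det3_def algebra_simps)
  have scale: "det3 (a / s) (b / s) 1 (a' / s') (b' / s') 1 (a'' / s'') (b'' / s'') 1
      = det3 a b s a' b' s' a'' b'' s'' / (s * s' * s'')"
    if "s \<noteq> 0" "s' \<noteq> 0" "s'' \<noteq> 0" for a b s a' b' s' a'' b'' s''
    using that by (simp add: det3_def field_simps)
  have prod: "det3 (x * a + y * b + z * c) (x * a' + y * b' + z * c') (x + y + z)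
      (x' * a + y' * b + z' * c) (x' * a' + y' * b' + z' * c') (x' + y' + z')
      (x'' * a + y'' * b + z'' * c) (x'' * a' + y'' * b' + z'' * c') (x'' + y'' + z'')
      = det3 x y z x' y' z' x'' y'' z'' * det3 a a' 1 b b' 1 c c' 1" for a b c a' b' c'
    unfolding det3_def by algebra
  show ?thesis
    unfolding hom using scale[OF assms]
    by (simp add: bary_def prod)
qed

lemma collinear_iff_area2: "collinear {A, B, C} \<longleftrightarrow> area2 A B C = 0"
proof (cases "A = B")
  case True
  then show ?thesis by (simp add: area2_def)
next
  case False
  then show ?thesis by (simp add: collinear_3_affine_hull in_affine_hull_iff_area2)
qed

lemma bary_vertex [simp]:
  "bary A B C 1 0 0 = A" "bary A B C 0 1 0 = B" "bary A B C 0 0 1 = C"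
  by (simp_all add: bary_def)

lemma bary_scale:
  assumes "k \<noteq> 0"
  shows "bary A B C (k * x) (k * y) (k * z) = bary A B C x y z"
proof -
  have "k * x + k * y + k * z = k * (x + y + z)" by (simp add: algebra_simps)
  moreover have "(k * x) *\<^sub>R A + (k * y) *\<^sub>R B + (k * z) *\<^sub>R C = k *\<^sub>R (x *\<^sub>R A + y *\<^sub>R B + z *\<^sub>R C)"
    by (simp add: algebra_simps)
  ultimately show ?thesis using assms by (simp add: bary_def)
qed

lemma bary_cyclic: "bary A B C x y z = bary B C A y z x" "bary A B C x y z = bary C A B z x y"
  by (simp_all add: bary_def ac_simps)

text \<open>Each outer weight carries the total weight of its point as a factor. That cancels all
  denominators, and the weights of the result are the plain linear combination.\<close>

lemma bary_bary:
  assumes "p1 + p2 + p3 \<noteq> 0" "q1 + q2 + q3 \<noteq> 0" "r1 + r2 + r3 \<noteq> 0"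
  shows "bary (bary A B C p1 p2 p3) (bary A B C q1 q2 q3) (bary A B C r1 r2 r3)
      (a * (p1 + p2 + p3)) (b * (q1 + q2 + q3)) (c * (r1 + r2 + r3)) =
    bary A B C (a * p1 + b * q1 + c * r1) (a * p2 + b * q2 + c * r2) (a * p3 + b * q3 + c * r3)"
proof -
  have "(k * s) *\<^sub>R (1 / s) *\<^sub>R X = k *\<^sub>R X" if "s \<noteq> 0" for k s :: real and X :: 'a
    using that by simp
  note scale = this[OF assms(1)] this[OF assms(2)] this[OF assms(3)]
  have "a * (p1 + p2 + p3) + b * (q1 + q2 + q3) + c * (r1 + r2 + r3) =
    (a * p1 + b * q1 + c * r1) + (a * p2 + b * q2 + c * r2) + (a * p3 + b * q3 + c * r3)"
    by (simp add: algebra_simps)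
  then show ?thesis
    unfolding bary_def scale by (simp only:) (simp add: scaleR_add_left scaleR_add_right ac_simps)
qed

text \<open>Equal points span with any third point a triangle of area zero; taking \<open>A\<close>, \<open>B\<close>, \<open>C\<close> as third
  point gives the minors of the two weight vectors one by one.\<close>

lemma bary_eqD:
  fixes A B C :: "real^2"
  assumes "\<not> collinear {A, B, C}" "p1 + p2 + p3 \<noteq> 0" "q1 + q2 + q3 \<noteq> 0"
    and eq: "bary A B C p1 p2 p3 = bary A B C q1 q2 q3"
  shows "p1 * q2 = p2 * q1" "p2 * q3 = p3 * q2" "p1 * q3 = p3 * q1"
proof -
  have "det3 p1 p2 p3 q1 q2 q3 r1 r2 r3 = 0" if "r1 + r2 + r3 \<noteq> 0" for r1 r2 r3
  proof -
    have "area2 (bary A B C p1 p2 p3) (bary A B C q1 q2 q3) (bary A B C r1 r2 r3) = 0"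
      unfolding eq by (simp add: area2_def)
    then show ?thesis
      using assms(1-3) that unfolding area2_bary[OF assms(2,3) that]
      by (simp add: collinear_iff_area2)
  qed
  from this[of 1 0 0] this[of 0 1 0] this[of 0 0 1]
  show "p1 * q2 = p2 * q1" "p2 * q3 = p3 * q2" "p1 * q3 = p3 * q1"
    by (simp_all add: det3_def)
qed

lemma bary_in_line_iff:
  assumes "\<not> collinear {A, B, C}"
    and "p1 + p2 + p3 \<noteq> 0" "q1 + q2 + q3 \<noteq> 0" "r1 + r2 + r3 \<noteq> 0"
    and "bary A B C p1 p2 p3 \<noteq> bary A B C q1 q2 q3"
  shows "Ordinary (bary A B C r1 r2 r3) \<in> line (bary A B C p1 p2 p3) (bary A B C q1 q2 q3)
    \<longleftrightarrow> det3 p1 p2 p3 q1 q2 q3 r1 r2 r3 = 0"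
  using assms by (simp add: line_eq_extend_line in_affine_hull_iff_area2 area2_bary collinear_iff_area2)

text \<open>The weights are the areas of the three triangles that \<open>P\<close> forms with the sides.\<close>

lemma bary_exists:
  fixes A B C P :: "real^2"
  assumes "\<not> collinear {A, B, C}"
  obtains x y z where "x + y + z = 1" "P = bary A B C x y z"
proof -
  define \<Delta> where "\<Delta> = area2 A B C"
  define x y z where "x = area2 P B C / \<Delta>" and "y = area2 A P C / \<Delta>" and "z = area2 A B P / \<Delta>"
  have \<Delta>: "\<Delta> \<noteq> 0" using assms by (simp add: collinear_iff_area2 \<Delta>_def)
  have "area2 P B C + area2 A P C + area2 A B P = \<Delta>"
    unfolding \<Delta>_def area2_def by algebra
  then have sum: "x + y + z = 1"
    using \<Delta> by (simp add: x_def y_def z_def flip: add_divide_distrib)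
  have cramer: "area2 P B C * A $ 1 + area2 A P C * B $ 1 + area2 A B P * C $ 1 = \<Delta> * P $ 1"
    "area2 P B C * A $ 2 + area2 A P C * B $ 2 + area2 A B P * C $ 2 = \<Delta> * P $ 2"
    unfolding \<Delta>_def area2_def by algebra+
  have "x * A $ 1 + y * B $ 1 + z * C $ 1 = P $ 1" "x * A $ 2 + y * B $ 2 + z * C $ 2 = P $ 2"
    using cramer \<Delta> unfolding x_def y_def z_def by (simp_all flip: add_divide_distrib)
  then have "P = bary A B C x y z"
    using sum by (simp add: bary_def vec_eq_iff forall_2)
  then show ?thesis using sum that by blast
qed

section \<open>Affine maps given by the images of a triangle\<close>

lemma affine_map_bary:
  assumes "affine_map T" "x + y + z \<noteq> 0"
  shows "T (bary A B C x y z) = bary (T A) (T B) (T C) x y z"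
proof -
  obtain L v where L: "linear L" "\<And>X. T X = L X + v" using assms(1) by (auto simp: affine_map_def)
  have "x *\<^sub>R (L A + v) + y *\<^sub>R (L B + v) + z *\<^sub>R (L C + v) =
      x *\<^sub>R L A + y *\<^sub>R L B + z *\<^sub>R L C + (x + y + z) *\<^sub>R v"
    by (simp add: algebra_simps)
  then have "bary (T A) (T B) (T C) x y z =
      (1 / (x + y + z)) *\<^sub>R (x *\<^sub>R L A + y *\<^sub>R L B + z *\<^sub>R L C) + v"
    using assms(2) unfolding bary_def L(2) by (simp only: scaleR_add_right[of "1 / (x + y + z)" _ "_ *\<^sub>R v"]) simp
  then show ?thesis
    by (simp add: bary_def L(2) linear_add[OF L(1)] linear_scale[OF L(1)])
qed

lemma affine_map_taking_unique:
  assumes "\<not> collinear {A, B, C}" "affine_map T" "affine_map U" "T A = U A" "T B = U B" "T C = U C"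
  shows "T = U"
proof
  fix P
  obtain x y z where "x + y + z = 1" "P = bary A B C x y z" using bary_exists[OF assms(1)] by blast
  then show "T P = U P" using assms by (simp add: affine_map_bary)
qed

lemma affine_map_taking:
  assumes "\<not> collinear {A, B, C}" "T = affine_map_taking A B C X Y Z"
  shows "affine_map T" "T A = X" "T B = Y" "T C = Z"
proof -
  define \<Delta> where "\<Delta> = area2 A B C"
  \<comment> \<open>The barycentric weights of \<open>B\<close> and \<open>C\<close> at \<open>A + V\<close> are linear in \<open>V\<close>; sending \<open>B - A\<close> to
      \<open>Y - X\<close> and \<open>C - A\<close> to \<open>Z - X\<close> determines the linear part.\<close>
  define L where "L V = (area2 A (A + V) C / \<Delta>) *\<^sub>R (Y - X) + (area2 A B (A + V) / \<Delta>) *\<^sub>R (Z - X)" for V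
  define U where "U V = L V + (X - L A)" for V
  have \<Delta>: "\<Delta> \<noteq> 0" using assms by (simp add: collinear_iff_area2 \<Delta>_def)
  have lin: "linear L"
  proof (rule linearI)
    show "L (V + W) = L V + L W" for V W
    proof -
      have "area2 A (A + (V + W)) C = area2 A (A + V) C + area2 A (A + W) C"
        "area2 A B (A + (V + W)) = area2 A B (A + V) + area2 A B (A + W)"
        by (simp_all add: area2_def algebra_simps)
      then show ?thesis by (simp only: L_def add_divide_distrib scaleR_add_left) (simp only: ac_simps)
    qed
    show "L (k *\<^sub>R V) = k *\<^sub>R L V" for k V
    proof -
      have "area2 A (A + k *\<^sub>R V) C = k * area2 A (A + V) C"
        "area2 A B (A + k *\<^sub>R V) = k * area2 A B (A + V)"
        by (simp_all add: area2_def algebra_simps)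
      then show ?thesis by (simp add: L_def scaleR_add_right)
    qed
  qed
  have "L (B - A) = Y - X" "L (C - A) = Z - X"
    using \<Delta> by (simp_all add: L_def \<Delta>_def[symmetric]) (simp_all add: area2_def)
  then have "U A = X" "U B = Y" "U C = Z"
    by (simp_all add: U_def linear_diff[OF lin] algebra_simps)
  moreover have "affine_map U" using lin by (auto simp: affine_map_def U_def)
  ultimately have U: "affine_map U \<and> U A = X \<and> U B = Y \<and> U C = Z" by blast
  have "T = U"
    unfolding assms(2) affine_map_taking_def using U affine_map_taking_unique[OF assms(1)]
    by (intro the_equality) auto
  then show "affine_map T" "T A = X" "T B = Y" "T C = Z" using U by auto
qed

lemma bij_affine_map:
  assumes "affine_map T" "\<not> collinear {A, B, C}" "\<not> collinear {T A, T B, T C}"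
  shows "bij T"
proof (rule bijI)
  show "inj T"
  proof (rule injI)
    fix X Y assume eq: "T X = T Y"
    obtain x y z where X: "x + y + z = 1" "X = bary A B C x y z" using bary_exists[OF assms(2)] by blast
    obtain x' y' z' where Y: "x' + y' + z' = 1" "Y = bary A B C x' y' z'" using bary_exists[OF assms(2)] by blast
    have "bary (T A) (T B) (T C) x y z = bary (T A) (T B) (T C) x' y' z'"
      using eq X Y assms(1) by (simp add: affine_map_bary)
    note minors = bary_eqD[OF assms(3) _ _ this]
    have "x * y' = y * x'" "y * z' = z * y'" "x * z' = z * x'" using minors X Y by auto
    then have "x = x'" "y = y'" "z = z'"
      using X(1) Y(1) by algebra+
    then show "X = Y" using X(2) Y(2) by (simp only:)
  qed
  show "surj T"
  proof (rule surjI)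
    fix Y
    obtain x y z where Y: "x + y + z = 1" "Y = bary (T A) (T B) (T C) x y z"
      using bary_exists[OF assms(3)] by blast
    then have "T (bary A B C x y z) = Y" using assms(1) by (simp add: affine_map_bary)
    then show "T (inv T Y) = Y" by (metis f_inv_into_f rangeI)
  qed
qed

section \<open>Coordinates of the points of the configuration\<close>

text \<open>The vertex \<open>Z\<close> has weight zero and is arbitrary: it lets a midpoint be read in any triangle
  that has the segment as a side.\<close>

lemma midpoint_eq_bary: "midpoint X Y = bary Z X Y 0 1 1"
  by (simp add: midpoint_def bary_def)

text \<open>The homothety sends \<open>X\<close> to \<open>(A + B + C - X) / 2\<close>, so normalised weights \<open>u\<close>
  become \<open>(1 - u) / 2\<close>.\<close>

lemma homothety_centroid_bary:
  assumes "x + y + z \<noteq> 0"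
  shows "homothety (centroid A B C) (-1/2) (bary A B C x y z) = bary A B C (y + z) (z + x) (x + y)"
proof -
  define s where "s = x + y + z"
  have "s \<noteq> 0" using assms by (simp add: s_def)
  have eq: "y + z = s - x" "z + x = s - y" "x + y = s - z" "s - x + (s - y) + (s - z) = 2 * s"
    by (simp_all add: s_def)
  have "a + (-1/2) * (u - a) = 1 / (2 * s) * w" if "a = (p + q + r) / 3" "u = 1/s * (x * p + y * q + z * r)"
     "w = (s - x) * p + (s - y) * q + (s - z) * r" for a u w p q r
    using \<open>s \<noteq> 0\<close> that by (simp add: field_simps)
  then show ?thesis
    unfolding bary_def eq s_def[symmetric]
    by (simp add: homothety_def centroid_def vec_eq_iff)
qed

lemma reflect_in_midpoint_bary:
  assumes "y + z \<noteq> 0"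
  shows "reflect_in (midpoint B C) (bary A B C 0 y z) = bary A B C 0 z y"
proof -
  have "bary A B C 0 y z + bary A B C 0 z y = (1 / (y + z)) *\<^sub>R (y + z) *\<^sub>R (B + C)"
    unfolding bary_def by (simp add: algebra_simps)
  then have "bary A B C 0 z y = B + C - bary A B C 0 y z" using assms by (simp add: eq_diff_eq add.commute)
  then show ?thesis by (simp add: reflect_in_def homothety_def midpoint_def algebra_simps flip: scaleR_2)
qed

text \<open>The trace has the weights of the point with that of \<open>A\<close> deleted: it is then on \<open>BC\<close>, and
  differs from the point by a multiple of \<open>A\<close>. The condition \<open>y + z \<noteq> 0\<close> says that the point is not on
  the parallel to \<open>BC\<close> through \<open>A\<close>.\<close>

lemma cevian_trace_bary:
  assumes nc: "\<not> collinear {A, B, C}" and "x + y + z \<noteq> 0" "y + z \<noteq> 0"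
  shows "cevian_trace A B C (bary A B C x y z) = bary A B C 0 y z"
proof -
  let ?P = "bary A B C x y z"
  have "A \<noteq> ?P"
    using bary_eqD[OF nc, of 1 0 0 x y z] assms by auto
  have "B \<noteq> C" using nc by auto
  have A: "Ordinary A \<notin> line B C"
    using bary_in_line_iff[OF nc, of 0 1 0 0 0 1 1 0 0] \<open>B \<noteq> C\<close> by (simp add: det3_def)
  have "meet (line A ?P) (line B C) = Ordinary (bary A B C 0 y z)"
  proof (rule meet_eqI)
    show "line A ?P \<noteq> line B C"
      using A Ordinary_endpoints_in_line(1)[OF \<open>A \<noteq> ?P\<close>] by blast
    show "Ordinary (bary A B C 0 y z) \<in> line A ?P"
      using bary_in_line_iff[OF nc, of 1 0 0 x y z 0 y z] \<open>A \<noteq> ?P\<close> assms by (simp add: det3_def)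
    show "Ordinary (bary A B C 0 y z) \<in> line B C"
      using bary_in_line_iff[OF nc, of 0 1 0 0 0 1 0 y z] \<open>B \<noteq> C\<close> assms by (simp add: det3_def)
  qed (use \<open>A \<noteq> ?P\<close> \<open>B \<noteq> C\<close> in \<open>simp_all add: is_xline_line\<close>)
  then show ?thesis by (simp add: cevian_trace_def)
qed

lemma cevian_traces_bary:
  assumes "\<not> collinear {A, B, C}" "x + y + z \<noteq> 0" "y + z \<noteq> 0" "z + x \<noteq> 0" "x + y \<noteq> 0"
  shows "cevian_trace A B C (bary A B C x y z) = bary A B C 0 y z"
    "cevian_trace B C A (bary A B C x y z) = bary A B C x 0 z"
    "cevian_trace C A B (bary A B C x y z) = bary A B C x y 0"
proof -
  have "\<not> collinear {B, C, A}" "y + z + x \<noteq> 0" "\<not> collinear {C, A, B}" "z + x + y \<noteq> 0"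
    using assms(1,2) by (simp_all add: insert_commute ac_simps)
  note at_each_vertex = cevian_trace_bary[OF assms(1-3)] cevian_trace_bary[OF this(1,2) assms(4)]
    cevian_trace_bary[OF this(3,4) assms(5)]
  from at_each_vertex show "cevian_trace A B C (bary A B C x y z) = bary A B C 0 y z"
    "cevian_trace B C A (bary A B C x y z) = bary A B C x 0 z"
    "cevian_trace C A B (bary A B C x y z) = bary A B C x y 0"
    unfolding bary_cyclic[of A B C, symmetric] by simp_all
qed

lemma reflected_traces_bary:
  assumes "y + z \<noteq> 0" "z + x \<noteq> 0" "x + y \<noteq> 0"
  shows "reflect_in (midpoint B C) (bary A B C 0 y z) = bary A B C 0 z y"
    "reflect_in (midpoint C A) (bary A B C x 0 z) = bary A B C z 0 x"
    "reflect_in (midpoint A B) (bary A B C x y 0) = bary A B C y x 0"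
  using reflect_in_midpoint_bary[of y z B C A] reflect_in_midpoint_bary[of z x C A B]
    reflect_in_midpoint_bary[of x y A B C] assms
  unfolding bary_cyclic[of A B C, symmetric] by simp_all

text \<open>The point with inverse weights is on the three lines \<open>AD\<^sub>3\<close>, \<open>BE\<^sub>3\<close>, \<open>CF\<^sub>3\<close>. If its total
  weight \<open>yz + zx + xy\<close> is zero, the same weights describe a vector instead of a point, and this vector
  is a common direction of the three lines; the isotomic conjugate is then infinite.\<close>

lemma isotomic_eq_Ordinary:
  assumes nc: "\<not> collinear {A, B, C}"
    and nz: "x \<noteq> 0" "y \<noteq> 0" "z \<noteq> 0" "x + y + z \<noteq> 0" "y + z \<noteq> 0" "z + x \<noteq> 0" "x + y \<noteq> 0"
    and P': "isotomic A B C (bary A B C x y z) = Ordinary P'"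
  shows "y * z + z * x + x * y \<noteq> 0" "P' = bary A B C (y * z) (z * x) (x * y)"
proof -
  let ?s = "y * z + z * x + x * y"
  define D where "D = bary A B C 0 z y"
  define E where "E = bary A B C z 0 x"
  define F where "F = bary A B C y x 0"
  have iso: "isotomic A B C (bary A B C x y z) =
      (THE X. X \<in> line A D \<and> X \<in> line B E \<and> X \<in> line C F)"
    using nz unfolding isotomic_def D_def E_def F_def
    by (simp only: cevian_traces_bary[OF nc] reflected_traces_bary not_False_eq_True simp_thms)
  have sums: "0 + z + y \<noteq> 0" "z + 0 + x \<noteq> 0" "y + x + 0 \<noteq> 0"
    using nz(5-7) by (simp_all add: add.commute)
  have ne: "A \<noteq> D" "B \<noteq> E" "C \<noteq> F"
    using bary_eqD(1)[OF nc _ sums(1), of 1 0 0] bary_eqD(1)[OF nc _ sums(2), of 0 1 0]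
      bary_eqD(2)[OF nc _ sums(3), of 0 0 1] nz(1-3)
    by (auto simp: D_def E_def F_def)
  have "Ordinary A \<notin> line B E"
    using bary_in_line_iff[OF nc, of 0 1 0 z 0 x 1 0 0] ne nz by (simp add: det3_def E_def add.commute)
  then have "line A D \<noteq> line B E" using Ordinary_endpoints_in_line[OF ne(1)] by auto
  \<comment> \<open>Two distinct lines already determine the common point, so it suffices to exhibit one.\<close>
  then have uniq: "isotomic A B C (bary A B C x y z) = X"
    if "X \<in> line A D" "X \<in> line B E" "X \<in> line C F" for X
    unfolding iso
    using that xline_unique[OF is_xline_line[OF ne(1)] is_xline_line[OF ne(2)]]
    by (intro the_equality) auto
  show s: "?s \<noteq> 0"
  proof
    assume s: "?s = 0"
    define w where "w = (y * z) *\<^sub>R A + (z * x) *\<^sub>R B + (x * y) *\<^sub>R C"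
    have "D - A = (1 / (x * (y + z))) *\<^sub>R w" "E - B = (1 / (y * (z + x))) *\<^sub>R w" "F - C = (1 / (z * (x + y))) *\<^sub>R w"
    proof -
      have yz: "y * z = - (z * x + x * y)" using s by simp
      have "w = x *\<^sub>R (z *\<^sub>R B + y *\<^sub>R C - (y + z) *\<^sub>R A)"
        unfolding w_def yz by (simp add: algebra_simps)
      moreover have "D - A = (1 / (y + z)) *\<^sub>R (z *\<^sub>R B + y *\<^sub>R C - (y + z) *\<^sub>R A)"
        using nz by (simp add: D_def bary_def scaleR_diff_right add.commute)
      ultimately show "D - A = (1 / (x * (y + z))) *\<^sub>R w" using nz by simp
    next
      have zx: "z * x = - (x * y + y * z)" using s by simp
      have "w = y *\<^sub>R (z *\<^sub>R A + x *\<^sub>R C - (z + x) *\<^sub>R B)"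
        unfolding w_def zx by (simp add: algebra_simps)
      moreover have "E - B = (1 / (z + x)) *\<^sub>R (z *\<^sub>R A + x *\<^sub>R C - (z + x) *\<^sub>R B)"
        using nz by (simp add: E_def bary_def scaleR_diff_right add.commute)
      ultimately show "E - B = (1 / (y * (z + x))) *\<^sub>R w" using nz by simp
    next
      have xy: "x * y = - (y * z + z * x)" using s by simp
      have "w = z *\<^sub>R (y *\<^sub>R A + x *\<^sub>R B - (x + y) *\<^sub>R C)"
        unfolding w_def xy by (simp add: algebra_simps)
      moreover have "F - C = (1 / (x + y)) *\<^sub>R (y *\<^sub>R A + x *\<^sub>R B - (x + y) *\<^sub>R C)"
        using nz by (simp add: F_def bary_def scaleR_diff_right add.commute)
      ultimately show "F - C = (1 / (z * (x + y))) *\<^sub>R w" using nz by simp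
    qed
    moreover have "w \<noteq> 0" using calculation(1) ne(1) by auto
    ultimately have "isotomic A B C (bary A B C x y z) = Infinite (Abs_direction (span {w}))"
      using ne by (intro uniq) (auto intro: Infinite_in_line)
    then show False using P' by simp
  qed
  have "isotomic A B C (bary A B C x y z) = Ordinary (bary A B C (y * z) (z * x) (x * y))"
  proof (rule uniq)
    let ?P = "bary A B C (y * z) (z * x) (x * y)"
    show "Ordinary ?P \<in> line A D"
      using bary_in_line_iff[OF nc _ sums(1) s, of 1 0 0] ne(1)
      by (simp add: D_def det3_def)
    show "Ordinary ?P \<in> line B E"
      using bary_in_line_iff[OF nc _ sums(2) s, of 0 1 0] ne(2)
      by (simp add: E_def det3_def)
    show "Ordinary ?P \<in> line C F"
      using bary_in_line_iff[OF nc _ sums(3) s, of 0 0 1] ne(3)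
      by (simp add: F_def det3_def)
  qed
  then show "P' = bary A B C (y * z) (z * x) (x * y)" using P' by simp
qed

section \<open>The concurrent lines at one vertex\<close>

text \<open>The points \<open>D, E, F\<close> and \<open>D\<^sub>3, E\<^sub>3, F\<^sub>3\<close> appear only as images of \<open>A, B, C\<close> under the two
  affine maps, and \<open>P\<close>, \<open>P'\<close>, \<open>Q\<close>, \<open>Q'\<close> through weights that are permuted by a cyclic
  permutation of the vertices. In this form the statement can be instantiated at the other vertices
  and, since weights matter only up to a factor, with \<open>(x, y, z)\<close> replaced by
  \<open>(yz, zx, xy)\<close> and the roles of \<open>P\<close> and \<open>P'\<close> exchanged.\<close>

lemma vertex_concurrence:
  fixes A B C P P' Q Q' :: "real^2"
  assumes nc: "\<not> collinear {A, B, C}"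
    and nz: "x \<noteq> 0" "y \<noteq> 0" "z \<noteq> 0" "x + y + z \<noteq> 0" "y + z \<noteq> 0" "z + x \<noteq> 0" "x + y \<noteq> 0"
      "y * z + z * x + x * y \<noteq> 0" "y \<noteq> z"
    and T: "affine_map T" "inj T" "T A = bary A B C 0 y z" "T B = bary A B C x 0 z" "T C = bary A B C x y 0"
    and T': "affine_map T'" "T' A = bary A B C 0 z y" "T' B = bary A B C z 0 x" "T' C = bary A B C y x 0"
    and P: "P = bary A B C x y z" "P' = bary A B C (y * z) (z * x) (x * y)"
    and Q: "Q = bary A B C (z * x + x * y) (x * y + y * z) (y * z + z * x)"
      "Q' = bary A B C (y + z) (z + x) (x + y)"
  shows "meet (line (midpoint (T' B) (T' C)) P') (line (midpoint B C) Q) = Ordinary (T' (inv T A)) \<and>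
    concurrent_at {line (midpoint (T' B) (T' C)) P', line (midpoint B C) Q, line (T' A) Q', line (T (T' A)) P}
      (Ordinary (T' (inv T A)))"
proof -
  let ?M = "midpoint (T' B) (T' C)"
  have weights: "0 + y + z \<noteq> 0" "x + 0 + z \<noteq> 0" "x + y + 0 \<noteq> 0"
    "0 + z + y \<noteq> 0" "z + 0 + x \<noteq> 0" "y + x + 0 \<noteq> 0"
    using nz(5-7) by (simp_all add: add.commute)
  \<comment> \<open>The combination \<open>-D + E + F\<close> of the weights \<open>(0, y, z)\<close>, \<open>(x, 0, z)\<close>, \<open>(x, y, 0)\<close> is
      \<open>(2x, 0, 0)\<close>, the vertex \<open>A\<close>.\<close>
  have "T (bary A B C (- (y + z)) (z + x) (x + y)) = A"
    using bary_bary[OF weights(1-3), of A B C "-1" 1 1] nz(1) bary_scale[of "2 * x" A B C 1 0 0]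
    by (simp add: affine_map_bary T add.commute)
  then have "inv T A = bary A B C (- (y + z)) (z + x) (x + y)"
    using T(2) by (metis inv_f_f)
  then have X: "T' (inv T A) = bary A B C (y + z) (x - z) (x - y)" (is "_ = ?X")
    using bary_bary[OF weights(4-6), of A B C "-1" 1 1] nz(1)
    by (simp add: affine_map_bary T' add.commute)
  have k: "(x + y) * (z + x) \<noteq> 0" using nz by simp
  have "?M = bary A (T' B) (T' C) 0 ((x + y) * (z + x)) ((x + y) * (z + x))"
    using bary_scale[OF k, of A "T' B" "T' C" 0 1 1] by (simp add: midpoint_eq_bary[of _ _ A])
  also have "\<dots> = bary A B C (y * z + z * x + x * y + y * z) (x * (z + x)) (x * (x + y))"
    using bary_bary[OF _ weights(5,6), of 1 0 0 A B C 0 "x + y" "z + x"]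
    by (simp add: T' algebra_simps)
  finally have M: "?M = bary A B C (y * z + z * x + x * y + y * z) (x * (z + x)) (x * (x + y))" .
  have D0: "midpoint B C = bary A B C 0 1 1" by (rule midpoint_eq_bary)
  \<comment> \<open>The weights \<open>(0, z, y)\<close> of \<open>T' A\<close> are multiplied by the total weights of \<open>T B\<close> and
      \<open>T C\<close>, so that the combination below has no denominators.\<close>
  have "T (T' A) = bary (T A) (T B) (T C) 0 (z * (x + y) * (z + x)) (y * (z + x) * (x + y))"
    using bary_scale[OF k, of "T A" "T B" "T C" 0 z y] nz(5)
    by (simp add: affine_map_bary[OF T(1)] T'(2) ac_simps)
  also have "\<dots> = bary A B C (x * (y * z + z * x + x * y + y * z)) (y * y * (z + x)) (z * z * (x + y))"
    using bary_bary[OF weights(1-3), of A B C 0 "z * (x + y)" "y * (z + x)"]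
    by (simp add: T algebra_simps)
  finally have A3: "T (T' A) = bary A B C (x * (y * z + z * x + x * y + y * z)) (y * y * (z + x)) (z * z * (x + y))" .
  have prods: "x * (y * z + z * x + x * y + y * z) + y * y * (z + x) + z * z * (x + y) = (y + z) * (z + x) * (x + y)"
    "y * z + z * x + x * y + y * z + x * (z + x) + x * (x + y) = 2 * ((z + x) * (x + y))"
    "z * x + x * y + (x * y + y * z) + (y * z + z * x) = 2 * (y * z + z * x + x * y)"
    "(y + z) + (z + x) + (x + y) = 2 * (x + y + z)"
    "(y + z) + (x - z) + (x - y) = 2 * x"
    "0 + z + y = y + z"
    by (simp_all add: algebra_simps)
  have sums: "x * (y * z + z * x + x * y + y * z) + y * y * (z + x) + z * z * (x + y) \<noteq> 0"
    "y * z + z * x + x * y + y * z + x * (z + x) + x * (x + y) \<noteq> 0"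
    "z * x + x * y + (x * y + y * z) + (y * z + z * x) \<noteq> 0"
    "(y + z) + (z + x) + (x + y) \<noteq> 0" "(y + z) + (x - z) + (x - y) \<noteq> 0"
    "0 + z + y \<noteq> 0" "0 + 1 + 1 \<noteq> (0::real)"
    unfolding prods by (simp_all add: nz del: distrib_left_numeral)
  \<comment> \<open>The four lines are well defined. The assumption \<open>y \<noteq> z\<close>, that \<open>P\<close> is not on the median
      through \<open>A\<close>, enters here for the first and the last line.\<close>
  have ne: "?M \<noteq> P'" "midpoint B C \<noteq> Q" "T' A \<noteq> Q'" "T (T' A) \<noteq> P"
  proof -
    show "?M \<noteq> P'"
    proof
      assume "?M = P'"
      then have "x * (z + x) * (x * y) = x * (x + y) * (z * x)"
        using bary_eqD(2)[OF nc sums(2) nz(8)] unfolding M P by blast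
      moreover have "x * x * x * (y - z) = x * (z + x) * (x * y) - x * (x + y) * (z * x)"
        by (simp add: algebra_simps)
      ultimately have "x * x * x * (y - z) = 0" by simp
      then show False by (simp add: nz(1-3,9))
    qed
    show "midpoint B C \<noteq> Q"
    proof
      assume "midpoint B C = Q"
      then have "0 * (x * y + y * z) = 1 * (z * x + x * y)"
        using bary_eqD(1)[OF nc sums(7,3)] unfolding D0 Q by blast
      then have "x * (y + z) = 0" by algebra
      then show False by (simp add: nz)
    qed
    show "T' A \<noteq> Q'"
    proof
      assume "T' A = Q'"
      then have "0 * (z + x) = z * (y + z)"
        using bary_eqD(1)[OF nc sums(6,4)] unfolding T' Q by blast
      then show False by (simp add: nz)
    qed
    show "T (T' A) \<noteq> P"
    proof
      assume "T (T' A) = P"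
      then have "y * y * (z + x) * z = z * z * (x + y) * y"
        using bary_eqD(2)[OF nc sums(1) nz(4)] unfolding A3 P by blast
      moreover have "x * y * z * (y - z) = y * y * (z + x) * z - z * z * (x + y) * y"
        by (simp add: algebra_simps)
      ultimately have "x * y * z * (y - z) = 0" by simp
      then show False by (simp add: nz(1-3,9))
    qed
  qed
  note xlines = ne[THEN is_xline_line]
  have on: "Ordinary ?X \<in> line ?M P'" "Ordinary ?X \<in> line (midpoint B C) Q"
    "Ordinary ?X \<in> line (T' A) Q'" "Ordinary ?X \<in> line (T (T' A)) P"
  proof -
    show "Ordinary ?X \<in> line ?M P'"
      unfolding M P bary_in_line_iff[OF nc sums(2) nz(8) sums(5) ne(1)[unfolded M P]] det3_def by algebra
    show "Ordinary ?X \<in> line (midpoint B C) Q"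
      unfolding D0 Q bary_in_line_iff[OF nc sums(7,3,5) ne(2)[unfolded D0 Q]] det3_def by algebra
    show "Ordinary ?X \<in> line (T' A) Q'"
      unfolding T' Q bary_in_line_iff[OF nc sums(6,4,5) ne(3)[unfolded T' Q]] det3_def by algebra
    show "Ordinary ?X \<in> line (T (T' A)) P"
      unfolding A3 P bary_in_line_iff[OF nc sums(1) nz(4) sums(5) ne(4)[unfolded A3 P]] det3_def by algebra
  qed
  \<comment> \<open>The first two lines are distinct because \<open>P'\<close> is on the first one only. The factors of the
      determinant exclude a side, a median and \<open>P'\<close> at infinity.\<close>
  have "Ordinary P' \<notin> line (midpoint B C) Q"
  proof -
    have "det3 0 1 1 (z * x + x * y) (x * y + y * z) (y * z + z * x) (y * z) (z * x) (x * y)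
        = x * (z - y) * (y * z + z * x + x * y)"
      unfolding det3_def by algebra
    then show ?thesis
      unfolding D0 Q P bary_in_line_iff[OF nc sums(7,3) nz(8) ne(2)[unfolded D0 Q]]
      by (simp add: nz(1,8) nz(9)[symmetric])
  qed
  then have distinct: "line ?M P' \<noteq> line (midpoint B C) Q"
    using Ordinary_endpoints_in_line[OF ne(1)] by auto
  show ?thesis
    unfolding X
  proof
    show "meet (line ?M P') (line (midpoint B C) Q) = Ordinary ?X"
      by (rule meet_eqI[OF xlines(1,2) distinct on(1,2)])
    show "concurrent_at {line ?M P', line (midpoint B C) Q, line (T' A) Q', line (T (T' A)) P} (Ordinary ?X)"
      using xlines on distinct by (intro concurrent_atI[of _ _ "line ?M P'" "line (midpoint B C) Q"]) auto
  qed
qed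

lemma triangle_concurrence:
  fixes A B C P P' Q Q' :: "real^2"
  assumes nc: "\<not> collinear {A, B, C}"
    and nz: "x \<noteq> 0" "y \<noteq> 0" "z \<noteq> 0" "x + y + z \<noteq> 0" "y + z \<noteq> 0" "z + x \<noteq> 0" "x + y \<noteq> 0"
      "y * z + z * x + x * y \<noteq> 0" "y \<noteq> z" "z \<noteq> x" "x \<noteq> y"
    and T: "affine_map T" "inj T" "T A = bary A B C 0 y z" "T B = bary A B C x 0 z" "T C = bary A B C x y 0"
    and T': "affine_map T'" "T' A = bary A B C 0 z y" "T' B = bary A B C z 0 x" "T' C = bary A B C y x 0"
    and P: "P = bary A B C x y z" "P' = bary A B C (y * z) (z * x) (x * y)"
    and Q: "Q = bary A B C (z * x + x * y) (x * y + y * z) (y * z + z * x)"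
      "Q' = bary A B C (y + z) (z + x) (x + y)"
  shows "(meet (line (midpoint (T' B) (T' C)) P') (line (midpoint B C) Q) = Ordinary (T' (inv T A)) \<and>
      meet (line (midpoint (T' C) (T' A)) P') (line (midpoint C A) Q) = Ordinary (T' (inv T B)) \<and>
      meet (line (midpoint (T' A) (T' B)) P') (line (midpoint A B) Q) = Ordinary (T' (inv T C))) \<and>
    concurrent_at {line (midpoint (T' B) (T' C)) P', line (midpoint B C) Q, line (T' A) Q', line (T (T' A)) P}
      (Ordinary (T' (inv T A))) \<and>
    concurrent_at {line (midpoint (T' C) (T' A)) P', line (midpoint C A) Q, line (T' B) Q', line (T (T' B)) P}
      (Ordinary (T' (inv T B))) \<and>
    concurrent_at {line (midpoint (T' A) (T' B)) P', line (midpoint A B) Q, line (T' C) Q', line (T (T' C)) P}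
      (Ordinary (T' (inv T C)))"
proof -
  have nc': "\<not> collinear {B, C, A}" "\<not> collinear {C, A, B}"
    using nc by (simp_all add: insert_commute)
  have nz': "y + z + x \<noteq> 0" "z + x + y \<noteq> 0"
    "z * x + x * y + y * z \<noteq> 0" "x * y + y * z + z * x \<noteq> 0"
    using nz(4,8) by (simp_all add: ac_simps)
  note cyc = bary_cyclic[of A B C, symmetric]
  note atA = vertex_concurrence[OF nc nz(1-9) T T' P Q]
  note atB = vertex_concurrence[of B C A y z x T T', unfolded cyc,
      OF nc'(1) nz(2,3,1) nz'(1) nz(6,7,5) nz'(3) nz(10) T(1,2,4,5,3) T'(1,3,4,2) P Q]
  note atC = vertex_concurrence[of C A B z x y T T', unfolded cyc,
      OF nc'(2) nz(3,1,2) nz'(2) nz(7,5,6) nz'(4) nz(11) T(1,2,5,3,4) T'(1,4,2,3) P Q]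
  show ?thesis using atA atB atC by blast
qed

section \<open>The theorem\<close>

theorem theorem3p4:
  fixes A B C G P P' Q Q' D E F D0 E0 F0 D3 E3 F3 :: "real^2"
    and A0 B0 C0 A0' B0' C0' A3 B3 C3 A3' B3' C3' :: "real^2"
    and K T T' lam :: "real^2 \<Rightarrow> real^2"
  assumes triangle: "\<not> collinear {A, B, C}"
    and G: "G = centroid A B C"
    and K: "K = homothety G (-1/2)"
    and not_on_sides:
      "Ordinary P \<notin> line B C" "Ordinary P \<notin> line C A" "Ordinary P \<notin> line A B"
    and not_on_anticomplementary_sides:
      "Ordinary P \<notin> line (inv K B) (inv K C)"
      "Ordinary P \<notin> line (inv K C) (inv K A)"
      "Ordinary P \<notin> line (inv K A) (inv K B)"
    and not_on_medians:
      "Ordinary P \<notin> line A G" "Ordinary P \<notin> line B G" "Ordinary P \<notin> line C G"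
    and P'_ordinary: "isotomic A B C P = Ordinary P'"
    and Q: "Q = K P'" "Q' = K P"
    and midpoints: "D0 = midpoint B C" "E0 = midpoint C A" "F0 = midpoint A B"
    and traces: "D = cevian_trace A B C P" "E = cevian_trace B C A P" "F = cevian_trace C A B P"
    and reflections: "D3 = reflect_in D0 D" "E3 = reflect_in E0 E" "F3 = reflect_in F0 F"
    and T: "T = affine_map_taking A B C D E F"
    and T': "T' = affine_map_taking A B C D3 E3 F3"
    and cevian_midpoints: "A0 = midpoint E F" "B0 = midpoint F D" "C0 = midpoint D E"
    and cevian_midpoints': "A0' = midpoint E3 F3" "B0' = midpoint F3 D3" "C0' = midpoint D3 E3"
    and T_images: "A3 = T D3" "B3 = T E3" "C3 = T F3"
    and T'_images: "A3' = T' D" "B3' = T' E" "C3' = T' F"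
    and lam: "lam = T' \<circ> inv T"
  shows
    "(meet (line A0 P) (line D0 Q') = Ordinary (inv lam A) \<and>
      meet (line B0 P) (line E0 Q') = Ordinary (inv lam B) \<and>
      meet (line C0 P) (line F0 Q') = Ordinary (inv lam C) \<and>
      meet (line A0' P') (line D0 Q) = Ordinary (lam A) \<and>
      meet (line B0' P') (line E0 Q) = Ordinary (lam B) \<and>
      meet (line C0' P') (line F0 Q) = Ordinary (lam C)) \<and>
     (concurrent_at {line A0 P, line D0 Q', line D Q, line A3' P'} (Ordinary (inv lam A)) \<and>
      concurrent_at {line A0' P', line D0 Q, line D3 Q', line A3 P} (Ordinary (lam A)) \<and>
      concurrent_at {line B0 P, line E0 Q', line E Q, line B3' P'} (Ordinary (inv lam B)) \<and>
      concurrent_at {line B0' P', line E0 Q, line E3 Q', line B3 P} (Ordinary (lam B)) \<and>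
      concurrent_at {line C0 P, line F0 Q', line F Q, line C3' P'} (Ordinary (inv lam C)) \<and>
      concurrent_at {line C0' P', line F0 Q, line F3 Q', line C3 P} (Ordinary (lam C)))"
proof -
  have K_bary: "K (bary A B C u v w) = bary A B C (v + w) (w + u) (u + v)" if "u + v + w \<noteq> 0" for u v w
    using homothety_centroid_bary[OF that] by (simp add: K G)
  have "inj K"
    by (rule injI) (simp add: K homothety_def)
  \<comment> \<open>The vertices of the anticomplementary triangle are \<open>B + C - A\<close>, \<open>C + A - B\<close>, \<open>A + B - C\<close>.\<close>
  have "K (bary A B C (-1) 1 1) = A" "K (bary A B C 1 (-1) 1) = B" "K (bary A B C 1 1 (-1)) = C"
    using bary_scale[of 2 A B C 1 0 0] bary_scale[of 2 A B C 0 1 0] bary_scale[of 2 A B C 0 0 1]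
    by (simp_all add: K_bary)
  then have inv_K: "inv K A = bary A B C (-1) 1 1" "inv K B = bary A B C 1 (-1) 1" "inv K C = bary A B C 1 1 (-1)"
    using \<open>inj K\<close> by (simp_all add: inv_f_eq)
  have G_bary: "G = bary A B C 1 1 1" by (simp add: G centroid_def bary_def)
  obtain x y z where sum: "x + y + z = 1" and P: "P = bary A B C x y z"
    using bary_exists[OF triangle] by blast

  \<comment> \<open>Every position hypothesis on \<open>P\<close> becomes the nonvanishing of a linear form in \<open>x, y, z\<close>.\<close>
  have off_line: "det3 p1 p2 p3 q1 q2 q3 x y z \<noteq> 0"
    if "Ordinary P \<notin> line (bary A B C p1 p2 p3) (bary A B C q1 q2 q3)"
      "p1 + p2 + p3 \<noteq> 0" "q1 + q2 + q3 \<noteq> 0" "p1 * q2 \<noteq> p2 * q1 \<or> p2 * q3 \<noteq> p3 * q2 \<or> p1 * q3 \<noteq> p3 * q1"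
    for p1 p2 p3 q1 q2 q3
  proof -
    have "bary A B C p1 p2 p3 \<noteq> bary A B C q1 q2 q3"
      using bary_eqD[OF triangle that(2,3)] that(4) by blast
    then show ?thesis
      using bary_in_line_iff[OF triangle that(2,3), of x y z] that(1) sum P by simp
  qed
  have sides: "x \<noteq> 0" "y \<noteq> 0" "z \<noteq> 0"
    using off_line[of 0 1 0 0 0 1] off_line[of 0 0 1 1 0 0] off_line[of 1 0 0 0 1 0] not_on_sides
    by (simp_all add: det3_def)
  have anti: "y + z \<noteq> 0" "z + x \<noteq> 0" "x + y \<noteq> 0"
    using off_line[of 1 "-1" 1 1 1 "-1"] off_line[of 1 1 "-1" "-1" 1 1] off_line[of "-1" 1 1 1 "-1" 1]
      not_on_anticomplementary_sides
    by (auto simp: det3_def inv_K)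
  have medians: "y \<noteq> z" "z \<noteq> x" "x \<noteq> y"
    using off_line[of 1 0 0 1 1 1] off_line[of 0 1 0 1 1 1] off_line[of 0 0 1 1 1 1] not_on_medians
    by (auto simp: det3_def G_bary)
  have sum0: "x + y + z \<noteq> 0" using sum by simp
  note iso = isotomic_eq_Ordinary[OF triangle sides sum0 anti P'_ordinary[unfolded P]]
  note P' = iso(2)
  have Q_bary: "Q = bary A B C (z * x + x * y) (x * y + y * z) (y * z + z * x)"
    "Q' = bary A B C (y + z) (z + x) (x + y)"
    unfolding Q P P' using K_bary iso(1) sum0 by simp_all
  have traces_bary: "D = bary A B C 0 y z" "E = bary A B C x 0 z" "F = bary A B C x y 0"
    unfolding traces P using cevian_traces_bary[OF triangle sum0 anti] by simp_all
  have reflections_bary: "D3 = bary A B C 0 z y" "E3 = bary A B C z 0 x" "F3 = bary A B C y x 0"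
    unfolding reflections midpoints traces_bary using reflected_traces_bary[OF anti] by simp_all

  note T_facts = affine_map_taking[OF triangle T]
  note T'_facts = affine_map_taking[OF triangle T']
  have "\<not> collinear {D, E, F}" "\<not> collinear {D3, E3, F3}"
    using sides anti triangle
    by (simp_all add: traces_bary reflections_bary collinear_iff_area2 area2_bary det3_def add.commute)
  then have bij: "bij T" "bij T'"
    using bij_affine_map[OF T_facts(1) triangle] bij_affine_map[OF T'_facts(1) triangle]
    by (simp_all add: T_facts T'_facts)
  have "inv lam = T \<circ> inv T'"
    unfolding lam using bij by (simp add: o_inv_distrib bij_imp_bij_inv inv_inv_eq)
  then have lam_apply: "lam X = T' (inv T X)" "inv lam X = T (inv T' X)" for X
    by (simp_all add: lam)

  have TP: "T A = bary A B C 0 y z" "T B = bary A B C x 0 z" "T C = bary A B C x y 0"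
    "T' A = bary A B C 0 z y" "T' B = bary A B C z 0 x" "T' C = bary A B C y x 0"
    using T_facts T'_facts by (simp_all add: traces_bary reflections_bary)
  note at_lam = triangle_concurrence[OF triangle sides sum0 anti iso(1) medians
      T_facts(1) bij_is_inj[OF bij(1)] TP(1-3) T'_facts(1) TP(4-6) P P' Q_bary]

  \<comment> \<open>For the inverse of \<open>\<lambda>\<close>, the configuration of \<open>P'\<close>: its nondegeneracy conditions factor
      into those of \<open>P\<close>, and all weights agree with the earlier ones up to the factors \<open>x\<close>, \<open>y\<close>, \<open>z\<close> or
      \<open>xyz\<close>.\<close>
  have k: "x * y * z \<noteq> 0" using sides by simp
  have nz': "y * z \<noteq> 0" "z * x \<noteq> 0" "x * y \<noteq> 0" "z * x + x * y \<noteq> 0" "x * y + y * z \<noteq> 0" "y * z + z * x \<noteq> 0"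
    "z * x * (x * y) + x * y * (y * z) + y * z * (z * x) \<noteq> 0"
    "z * x \<noteq> x * y" "x * y \<noteq> y * z" "y * z \<noteq> z * x"
  proof -
    have "z * x + x * y = x * (y + z)" "x * y + y * z = y * (z + x)" "y * z + z * x = z * (x + y)"
      "z * x * (x * y) + x * y * (y * z) + y * z * (z * x) = x * y * z * (x + y + z)"
      by (simp_all add: algebra_simps)
    then show "z * x + x * y \<noteq> 0" "x * y + y * z \<noteq> 0" "y * z + z * x \<noteq> 0"
      "z * x * (x * y) + x * y * (y * z) + y * z * (z * x) \<noteq> 0"
      by (simp_all add: sides anti sum0)
  qed (use medians in \<open>simp_all add: sides\<close>)
  have TP': "T' A = bary A B C 0 (z * x) (x * y)" "T' B = bary A B C (y * z) 0 (x * y)" "T' C = bary A B C (y * z) (z * x) 0"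
    "T A = bary A B C 0 (x * y) (z * x)" "T B = bary A B C (x * y) 0 (y * z)" "T C = bary A B C (z * x) (y * z) 0"
    using TP bary_scale[OF sides(1), of A B C 0 z y] bary_scale[OF sides(2), of A B C z 0 x]
      bary_scale[OF sides(3), of A B C y x 0] bary_scale[OF sides(1), of A B C 0 y z]
      bary_scale[OF sides(2), of A B C x 0 z] bary_scale[OF sides(3), of A B C x y 0]
    by (simp_all add: mult.commute)
  have P_bary': "P = bary A B C (z * x * (x * y)) (x * y * (y * z)) (y * z * (z * x))"
    unfolding P bary_scale[OF k, of A B C x y z, symmetric] by (simp add: ac_simps)
  have Q_bary': "Q' = bary A B C (x * y * (y * z) + y * z * (z * x)) (y * z * (z * x) + z * x * (x * y))
      (z * x * (x * y) + x * y * (y * z))"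
    unfolding Q_bary bary_scale[OF k, of A B C "y + z" "z + x" "x + y", symmetric]
    by (simp add: algebra_simps)
  note at_inv_lam = triangle_concurrence[OF triangle nz'(1-3) iso(1) nz'(4-10)
      T'_facts(1) bij_is_inj[OF bij(2)] TP'(1-3) T_facts(1) TP'(4-6) P' P_bary' Q_bary' Q_bary(1)]

  show ?thesis
    unfolding cevian_midpoints cevian_midpoints' midpoints T_images T'_images lam_apply
    using at_lam at_inv_lam unfolding T_facts T'_facts by blast
qed

end
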